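(* Let $I \supset [0,\infty)$ be an open interval and let $f : I \to (0,\infty)$ be differentiable. Let $a \in [0,\infty)$, $b \ge 1$, $a<b$, let $p,q>1$ with $\frac1p+\frac1q=1$, and let $(\alpha,m) \in (0,1)\times(0,1)$. Suppose that $f' \in L[a,b]$, that $|f'|^{q}$ is decreasing and $(\alpha,m)$-geometrically convex on $[\min\{1,a\},b]$, and that $|f'(y)| \le M < 1$ for all $y \in [\min\{1,a\},b]$. Then for every $\mu>0$ and every $x \in [a,b]$, $$\left| \frac{(x-a)^{\mu}+(b-x)^{\mu}}{b-a} f(x) - \frac{\Gamma(\mu+1)}{b-a}\left[ J_{x^-}^{\mu} f(a) + J_{x^+}^{\mu} f(b) \right] \right| \le M^{m}\left(\frac{1}{p\mu+1}\right)^{\frac1p}\left(\frac{M^{q\alpha(1-m)}-1}{q\alpha(1-m)\ln M}\right)^{\frac1q}\left[ \frac{(x-a)^{\mu+1}+(b-x)^{\mu+1}}{b-a} \right].$$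
   Context: Let $(\alpha,m)\in(0,1]\times(0,1]$. A positive function $g$ is $(\alpha,m)$-geometrically convex on an interval $J\subset[0,\infty)$ if $g\left(x^{t}y^{m(1-t)}\right) \le [g(x)]^{t^{\alpha}}[g(y)]^{m(1-t^{\alpha})}$ for all $x,y\in J$ and $t\in[0,1]$. $L[a,b]$ denotes the Lebesgue integrable functions on $[a,b]$, and $\Gamma$ is the Gamma function. The Riemann-Liouville fractional integrals of order $\mu>0$ are $J_{c^+}^{\mu} f(x)=\frac{1}{\Gamma(\mu)}\int_c^x (x-t)^{\mu-1}f(t)\,dt$ for $x>c$ and $J_{d^-}^{\mu} f(x)=\frac{1}{\Gamma(\mu)}\int_x^d (t-x)^{\mu-1}f(t)\,dt$ for $x<d$. Thus $J_{x^-}^{\mu} f(a)=\frac{1}{\Gamma(\mu)}\int_a^x (t-a)^{\mu-1}f(t)\,dt$ and $J_{x^+}^{\mu} f(b)=\frac{1}{\Gamma(\mu)}\int_x^b (b-t)^{\mu-1}f(t)\,dt$ (each being $0$ when the integration interval is a point). *)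

theory Defs
  imports "HOL-Analysis.Analysis"
begin

text \<open>Real powers of nonnegative reals with the usual convention \<open>0\<^sup>0 = 1\<close>; the library
  has \<open>0 powr 0 = 0\<close>, which would give the wrong point \<open>x\<^sup>t y\<^bsup>m(1-t)\<^esup>\<close> below when
  \<open>x = 0, t = 0\<close> or \<open>y = 0, t = 1\<close>.\<close>

definition rpow :: "real \<Rightarrow> real \<Rightarrow> real" where
  "rpow x s = (if s = 0 then 1 else x powr s)"

text \<open>Intended for \<open>J \<subseteq> {0..}\<close> and \<open>\<alpha>, m \<in> {0<..1}\<close>. Here \<open>g\<close> is total, so membership
  of \<open>x\<^sup>t y\<^bsup>m(1-t)\<^esup>\<close> in \<open>J\<close> is not demanded; it is automatic for \<open>J = {min 1 a..b}\<close> with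
  \<open>0 \<le> a\<close> and \<open>1 \<le> b\<close>. The remaining powers have a positive base or a positive exponent, so
  \<open>powr\<close> is the usual power there.\<close>

definition am_geometrically_convex_on ::
    "real \<Rightarrow> real \<Rightarrow> real set \<Rightarrow> (real \<Rightarrow> real) \<Rightarrow> bool" where
  "am_geometrically_convex_on \<alpha> m J g \<longleftrightarrow>
     (\<forall>x\<in>J. g x > 0) \<and>
     (\<forall>x\<in>J. \<forall>y\<in>J. \<forall>t\<in>{0..1}.
        g (rpow x t * rpow y (m * (1 - t)))
          \<le> g x powr (t powr \<alpha>) * g y powr (m * (1 - t powr \<alpha>)))"

text \<open>\<open>RL_left \<mu> c f x\<close> is \<open>(J\<^bsub>c+\<^esub>\<^sup>\<mu> f)(x)\<close> and \<open>RL_right \<mu> d f x\<close> is \<open>(J\<^bsub>d-\<^esub>\<^sup>\<mu> f)(x)\<close>, so the base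
  point precedes the function and the evaluation point comes last. The value of the kernel at
  the single point \<open>t = x\<close> does not affect the integral.\<close>

definition RL_left :: "real \<Rightarrow> real \<Rightarrow> (real \<Rightarrow> real) \<Rightarrow> real \<Rightarrow> real" where
  "RL_left \<mu> c f x =
     1 / Gamma \<mu> * (LINT t:{c..x}|lebesgue. (x - t) powr (\<mu> - 1) * f t)"

definition RL_right :: "real \<Rightarrow> real \<Rightarrow> (real \<Rightarrow> real) \<Rightarrow> real \<Rightarrow> real" where
  "RL_right \<mu> d f x =
     1 / Gamma \<mu> * (LINT t:{x..d}|lebesgue. (t - x) powr (\<mu> - 1) * f t)"

end

theory Submission
  imports Defs
begin

text \<open>Writing \<open>(x - a)\<^sup>\<mu> = \<mu> \<integral>\<^bsub>a\<^esub>\<^bsup>x\<^esup> (t - a)\<^bsup>\<mu> - 1\<^esup> dt\<close>, the left half of the difference is, up to \<open>1 / (b - a)\<close>,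
  \<open>\<mu> \<integral>\<^bsub>a\<^esub>\<^bsup>x\<^esup> (t - a)\<^bsup>\<mu> - 1\<^esup> (f x - f t) dt\<close>, and the mean value theorem bounds it by
  \<open>M (x - a)\<^bsup>\<mu> + 1\<^esup> / (\<mu> + 1)\<close>; the right half is symmetric. It remains to compare constants:
  \<open>1 / (\<mu> + 1) \<le> (1 / (p\<mu> + 1))\<^bsup>1/p\<^esup>\<close> is Young's inequality for \<open>p\<mu> + 1\<close> and \<open>1\<close>, and the quotient with \<open>ln M\<close> is the
  mean of \<open>M\<^bsup>cs\<^esup>\<close> over \<open>s \<in> [0, 1]\<close>, where \<open>c = q\<alpha>(1 - m)\<close>. This mean is at least
  \<open>M\<^bsup>c\<^esup>\<close>, so the remaining factor is at least \<open>M\<^bsup>m + \<alpha>(1 - m)\<^esup> \<ge> M\<close>.\<close>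

lemma has_integral_powr_left:
  fixes a x \<mu> :: real
  assumes "a \<le> x" "\<mu> > 0"
  shows "((\<lambda>t. (t - a) powr (\<mu> - 1)) has_integral (x - a) powr \<mu> / \<mu>) {a..x}"
proof -
  \<comment> \<open>For \<mu> < 1 the kernel blows up at \<open>a\<close>, so the antiderivative is
    differentiated only in the open interval and is merely continuous at the ends.\<close>
  have "((\<lambda>t. (t - a) powr (\<mu> - 1)) has_integral
      (x - a) powr \<mu> / \<mu> - (a - a) powr \<mu> / \<mu>) {a..x}"
  proof (rule fundamental_theorem_of_calculus_interior[OF assms(1)])
    show "continuous_on {a..x} (\<lambda>t. (t - a) powr \<mu> / \<mu>)"
      using assms by (auto intro!: continuous_intros continuous_on_powr')
    fix t assume "t \<in> {a<..<x}"
    then show "((\<lambda>t. (t - a) powr \<mu> / \<mu>) has_vector_derivative (t - a) powr (\<mu> - 1)) (at t)"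
      unfolding has_real_derivative_iff_has_vector_derivative[symmetric]
      using assms by (auto intro!: derivative_eq_intros)
  qed
  then show ?thesis by simp
qed

lemma has_integral_powr_left_mult:
  fixes a x \<mu> :: real
  assumes "a \<le> x" "\<mu> > 0"
  shows "((\<lambda>t. (t - a) powr (\<mu> - 1) * \<bar>x - t\<bar>) has_integral
    (x - a) powr (\<mu> + 1) / (\<mu> * (\<mu> + 1))) {a..x}"
proof -
  \<comment> \<open>Integration by parts: the first term integrates the kernel against
    \<open>x - t\<close>, the second compensates for the derivative -1 of that factor. Only the
    second survives at \<open>x\<close>, and neither at \<open>a\<close>.\<close>
  let ?F = "\<lambda>t. (x - t) * (t - a) powr \<mu> / \<mu> + (t - a) powr (\<mu> + 1) / (\<mu> * (\<mu> + 1))"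
  have "((\<lambda>t. (t - a) powr (\<mu> - 1) * \<bar>x - t\<bar>) has_integral ?F x - ?F a) {a..x}"
  proof (rule fundamental_theorem_of_calculus_interior[OF assms(1)])
    show "continuous_on {a..x} ?F"
      using assms by (auto intro!: continuous_intros continuous_on_powr')
    fix t assume t: "t \<in> {a<..<x}"
    have d: "((\<lambda>t. (t - a) powr r) has_real_derivative r * (t - a) powr (r - 1)) (at t)" for r
      using t by (auto intro!: derivative_eq_intros)
    have "(?F has_real_derivative
        ((- 1) * (t - a) powr \<mu> + \<mu> * (t - a) powr (\<mu> - 1) * (x - t)) / \<mu>
        + (\<mu> + 1) * (t - a) powr (\<mu> + 1 - 1) / (\<mu> * (\<mu> + 1))) (at t)"
      by (intro DERIV_add DERIV_cdivide DERIV_mult d) (auto intro!: derivative_eq_intros)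
    moreover have "((- 1) * (t - a) powr \<mu> + \<mu> * (t - a) powr (\<mu> - 1) * (x - t)) / \<mu>
        + (\<mu> + 1) * (t - a) powr (\<mu> + 1 - 1) / (\<mu> * (\<mu> + 1))
        = (t - a) powr (\<mu> - 1) * \<bar>x - t\<bar>"
      using t assms by (simp add: divide_simps)
    ultimately show "(?F has_vector_derivative (t - a) powr (\<mu> - 1) * \<bar>x - t\<bar>) (at t)"
      unfolding has_real_derivative_iff_has_vector_derivative[symmetric] by simp
  qed
  then show ?thesis by simp
qed

lemma has_integral_powr_right:
  fixes b x \<mu> :: real
  assumes "x \<le> b" "\<mu> > 0"
  shows "((\<lambda>t. (b - t) powr (\<mu> - 1)) has_integral (b - x) powr \<mu> / \<mu>) {x..b}"
  \<comment> \<open>The substitution t -> -t turns the kernel based at \<open>- b\<close> on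
    \<open>{- b..- x}\<close> into the one ending at \<open>b\<close>.\<close>
  using has_integral_reflect_real[THEN iffD2, OF has_integral_powr_left[of "- b" "- x" \<mu>]] assms by simp

lemma has_integral_powr_right_mult:
  fixes b x \<mu> :: real
  assumes "x \<le> b" "\<mu> > 0"
  shows "((\<lambda>t. (b - t) powr (\<mu> - 1) * \<bar>x - t\<bar>) has_integral
    (b - x) powr (\<mu> + 1) / (\<mu> * (\<mu> + 1))) {x..b}"
  using has_integral_reflect_real[THEN iffD2, OF has_integral_powr_left_mult[of "- b" "- x" \<mu>]] assms
  by (simp add: abs_minus_commute)

text \<open>Since \<open>W\<close> is the total mass of \<open>w\<close>, the difference is the
  integral of \<open>w t * (f x - f t)\<close>. The weight is left abstract so that both kernels,
  possibly unbounded, are covered.\<close>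

lemma weighted_integral_deviation:
  fixes f w :: "real \<Rightarrow> real"
  assumes w: "(w has_integral W) {c..d}" "\<And>t. t \<in> {c..d} \<Longrightarrow> 0 \<le> w t"
    and K: "((\<lambda>t. w t * \<bar>x - t\<bar>) has_integral K) {c..d}"
    and f: "continuous_on {c..d} f"
    and lip: "\<And>t. t \<in> {c..d} \<Longrightarrow> \<bar>f x - f t\<bar> \<le> M * \<bar>x - t\<bar>"
  shows "\<bar>W * f x - (LINT t:{c..d}|lebesgue. w t * f t)\<bar> \<le> M * K"
proof -
  \<comment> \<open>Nonnegativity upgrades gauge integrability of \<open>w\<close> to Lebesgue
    integrability; multiplying by the bounded measurable \<open>f\<close> preserves it.\<close>
  have "w absolutely_integrable_on {c..d}"
    using w by (auto intro: nonnegative_absolutely_integrable_1)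
  moreover have "f \<in> borel_measurable (lebesgue_on {c..d})"
    using f by (simp add: continuous_imp_measurable_on_sets_lebesgue)
  moreover have "bounded (f ` {c..d})"
    using f by (simp add: compact_continuous_image compact_imp_bounded)
  ultimately have ai: "(\<lambda>t. f t * w t) absolutely_integrable_on {c..d}"
    by (intro absolutely_integrable_bounded_measurable_product_real) auto
  then have ai: "(\<lambda>t. w t * f t) absolutely_integrable_on {c..d}"
    by (simp add: mult.commute)
  define L where "L = (LINT t:{c..d}|lebesgue. w t * f t)"
  have "((\<lambda>t. w t * f t) has_integral L) {c..d}"
    using ai unfolding L_def by (rule has_integral_set_lebesgue)
  then have "((\<lambda>t. w t * f x - w t * f t) has_integral (W * f x - L)) {c..d}"
    using w(1) by (intro has_integral_diff has_integral_mult_left)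
  then have D: "((\<lambda>t. w t * (f x - f t)) has_integral (W * f x - L)) {c..d}"
    by (simp add: right_diff_distrib)
  have B: "((\<lambda>t. M * (w t * \<bar>x - t\<bar>)) has_integral M * K) {c..d}"
    using K by (rule has_integral_mult_right)
  have "\<bar>w t * (f x - f t)\<bar> \<le> M * (w t * \<bar>x - t\<bar>)" if "t \<in> {c..d}" for t
    using mult_left_mono[OF lip w(2)] that w(2)[OF that] by (simp add: abs_mult mult_ac)
  then have "norm (integral {c..d} (\<lambda>t. w t * (f x - f t))) \<le> integral {c..d} (\<lambda>t. M * (w t * \<bar>x - t\<bar>))"
    using D B by (intro integral_norm_bound_integral) auto
  then show ?thesis
    unfolding integral_unique[OF D] integral_unique[OF B] L_def by simp
qed

text \<open>The two sides are the L^1 and L^p norms of s^\<mu> on [0, 1].\<close>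

lemma inverse_add_one_le_powr:
  fixes p \<mu> :: real
  assumes "1 \<le> p" "0 \<le> \<mu>"
  shows "1 / (\<mu> + 1) \<le> (1 / (p * \<mu> + 1)) powr (1 / p)"
proof -
  \<comment> \<open>The weights 1/p and 1 - 1/p are chosen so that the arithmetic mean is exactly
    \<mu> + 1.\<close>
  have "(p * \<mu> + 1) powr (1 / p) * 1 powr (1 - 1 / p) \<le> 1 / p * (p * \<mu> + 1) + (1 - 1 / p) * 1"
    using assms by (intro Youngs_inequality_0) (auto simp: add_nonneg_pos)
  also have "\<dots> = \<mu> + 1"
    using assms by (simp add: field_simps)
  finally have "(p * \<mu> + 1) powr (1 / p) \<le> \<mu> + 1"
    by simp
  moreover have "0 < p * \<mu> + 1"
    using assms by (simp add: add_nonneg_pos)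
  ultimately show ?thesis
    using assms by (simp add: powr_divide frac_le)
qed

lemma powr_le_mean_powr:
  fixes M c :: real
  assumes "0 < M" "M < 1" "0 < c"
  shows "M powr c \<le> (M powr c - 1) / (c * ln M)"
proof -
  have neg: "c * ln M < 0"
    using assms by (simp add: mult_pos_neg)
  \<comment> \<open>Multiplying by \<open>M powr c\<close>, which is exp (c ln M), makes the right
    side 1; dividing by the negative c ln M then reverses the inequality.\<close>
  have "1 + (- (c * ln M)) \<le> exp (- (c * ln M))"
    by (rule exp_ge_add_one_self)
  then have "M powr c * (1 - c * ln M) \<le> M powr c * exp (- (c * ln M))"
    using assms by (intro mult_left_mono) auto
  also have "\<dots> = 1"
    using assms by (simp add: powr_def flip: exp_add)
  finally show ?thesis
    using neg by (simp add: neg_le_divide_eq algebra_simps)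
qed

theorem theorem3:
  fixes I :: "real set" and f :: "real \<Rightarrow> real"
    and a b p q \<alpha> m M \<mu> x :: real
  assumes "open I" and "is_interval I" and "{0..} \<subseteq> I"
    and "\<And>y. y \<in> I \<Longrightarrow> f y > 0"
    and "f differentiable_on I"
    and "0 \<le> a" and "1 \<le> b" and "a < b"
    and "p > 1" and "q > 1" and "1 / p + 1 / q = 1"
    and "0 < \<alpha>" and "\<alpha> < 1" and "0 < m" and "m < 1"
    and "set_integrable lebesgue {a..b} (deriv f)"
    and "antimono_on {min 1 a..b} (\<lambda>y. \<bar>deriv f y\<bar> powr q)"
    and "am_geometrically_convex_on \<alpha> m {min 1 a..b} (\<lambda>y. \<bar>deriv f y\<bar> powr q)"
    and "\<And>y. y \<in> {min 1 a..b} \<Longrightarrow> \<bar>deriv f y\<bar> \<le> M" and "M < 1"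
    and "\<mu> > 0" and "x \<in> {a..b}"
  shows "\<bar>((x - a) powr \<mu> + (b - x) powr \<mu>) / (b - a) * f x
            - Gamma (\<mu> + 1) / (b - a) * (RL_right \<mu> x f a + RL_left \<mu> x f b)\<bar>
         \<le> M powr m * (1 / (p * \<mu> + 1)) powr (1 / p)
            * ((M powr (q * \<alpha> * (1 - m)) - 1) / (q * \<alpha> * (1 - m) * ln M)) powr (1 / q)
            * (((x - a) powr (\<mu> + 1) + (b - x) powr (\<mu> + 1)) / (b - a))"
proof -
  \<comment> \<open>The convexity predicate includes positivity, here at \<open>b\<close>; it forces
    M > 0, so \<open>ln M\<close> is negative and powers of \<open>M\<close> are genuine.\<close>
  have "0 < \<bar>deriv f b\<bar> powr q"
    using assms(7,18) unfolding am_geometrically_convex_on_def by auto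
  then have "0 < \<bar>deriv f b\<bar>"
    by (cases "deriv f b = 0") auto
  moreover have "\<bar>deriv f b\<bar> \<le> M"
    using assms(7,19) by auto
  ultimately have M0: "0 < M"
    by linarith
  have sub: "{a..b} \<subseteq> I"
    using assms(3,6) by auto
  have cont: "continuous_on {a..b} f"
    using assms(5) sub by (meson continuous_on_subset differentiable_imp_continuous_on)
  \<comment> \<open>Openness of \<open>I\<close> gives a two-sided derivative at every point, even
    at \<open>a\<close> = 0.\<close>
  have der: "(f has_field_derivative deriv f t) (at t within {a..b})" if "t \<in> {a..b}" for t
  proof -
    have "f differentiable (at t)"
      using that sub assms(1,5) by (auto simp: differentiable_on_eq_differentiable_at)
    then have "(f has_field_derivative deriv f t) (at t)"
      by (simp add: DERIV_deriv_iff_real_differentiable)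
    then show ?thesis
      by (rule has_field_derivative_at_within)
  qed
  have lip: "\<bar>f x - f t\<bar> \<le> M * \<bar>x - t\<bar>" if "t \<in> {a..b}" for t
  proof -
    have "norm (deriv f z) \<le> M" if "z \<in> {a..b}" for z
      using assms(19)[of z] that by auto
    from field_differentiable_bound[OF _ der this assms(22) that] show ?thesis
      by simp
  qed
  let ?L = "LINT t:{a..x}|lebesgue. (t - a) powr (\<mu> - 1) * f t"
  let ?R = "LINT t:{x..b}|lebesgue. (b - t) powr (\<mu> - 1) * f t"
  let ?u = "(x - a) powr \<mu>" and ?v = "(b - x) powr \<mu>"
  let ?U = "(x - a) powr (\<mu> + 1)" and ?V = "(b - x) powr (\<mu> + 1)"
  have ax: "a \<le> x" "x \<le> b"
    using assms(22) by auto
  have L: "\<bar>?u / \<mu> * f x - ?L\<bar> \<le> M * (?U / (\<mu> * (\<mu> + 1)))"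
  proof (rule weighted_integral_deviation[OF has_integral_powr_left[OF ax(1) assms(21)] _
        has_integral_powr_left_mult[OF ax(1) assms(21)]])
    show "continuous_on {a..x} f"
      using cont by (rule continuous_on_subset) (use ax in auto)
    show "\<bar>f x - f t\<bar> \<le> M * \<bar>x - t\<bar>" if "t \<in> {a..x}" for t
      using lip[of t] that ax by simp
  qed simp
  have R: "\<bar>?v / \<mu> * f x - ?R\<bar> \<le> M * (?V / (\<mu> * (\<mu> + 1)))"
  proof (rule weighted_integral_deviation[OF has_integral_powr_right[OF ax(2) assms(21)] _
        has_integral_powr_right_mult[OF ax(2) assms(21)]])
    show "continuous_on {x..b} f"
      using cont by (rule continuous_on_subset) (use ax in auto)
    show "\<bar>f x - f t\<bar> \<le> M * \<bar>x - t\<bar>" if "t \<in> {x..b}" for t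
      using lip[of t] that ax by simp
  qed simp
  have G: "Gamma (\<mu> + 1) = \<mu> * Gamma \<mu>" "Gamma \<mu> > 0"
    using assms(21) by (auto simp: Gamma_plus1 nonpos_Ints_def intro!: Gamma_real_pos)
  \<comment> \<open>The factor \<mu> left by Gamma (\<mu> + 1) / Gamma \<mu> is pulled out, so that
    \<open>?u / \<mu>\<close> and \<open>?v / \<mu>\<close> are the masses of the two
    kernels.\<close>
  have "(?u + ?v) / (b - a) * f x - Gamma (\<mu> + 1) / (b - a) * (RL_right \<mu> x f a + RL_left \<mu> x f b)
      = \<mu> / (b - a) * ((?u / \<mu> * f x - ?L) + (?v / \<mu> * f x - ?R))"
  proof -
    have "Gamma (\<mu> + 1) * (RL_right \<mu> x f a + RL_left \<mu> x f b) = \<mu> * (?L + ?R)"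
      using G unfolding RL_right_def RL_left_def by (simp add: field_simps)
    then have "Gamma (\<mu> + 1) / (b - a) * (RL_right \<mu> x f a + RL_left \<mu> x f b)
        = \<mu> * (?L + ?R) / (b - a)"
      by simp
    moreover have "\<mu> / (b - a) * (w / \<mu> * f x - K) = w / (b - a) * f x - \<mu> * K / (b - a)" for w K
      using assms(21) by (simp add: right_diff_distrib)
    ultimately show ?thesis
      by (simp add: distrib_left add_divide_distrib distrib_right)
  qed
  also have "\<bar>\<dots>\<bar> \<le> \<mu> / (b - a) * (M * (?U / (\<mu> * (\<mu> + 1))) + M * (?V / (\<mu> * (\<mu> + 1))))"
    using L R assms(8,21) by (subst abs_mult) (intro mult_mono; simp)
  also have "\<dots> = M * (1 / (\<mu> + 1)) * ((?U + ?V) / (b - a))"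
    using assms(8,21) by (simp add: divide_simps) (simp add: algebra_simps)
  also have "\<dots> \<le> M powr m * (1 / (p * \<mu> + 1)) powr (1 / p)
      * ((M powr (q * \<alpha> * (1 - m)) - 1) / (q * \<alpha> * (1 - m) * ln M)) powr (1 / q)
      * ((?U + ?V) / (b - a))"
  proof (rule mult_right_mono)
    \<comment> \<open>The exponent is at most 1, and a base below 1 reverses the order of powers.
      The part \<alpha>(1 - m) is then written as c/q to match the mean.\<close>
    have "m + \<alpha> * (1 - m) \<le> m + 1 * (1 - m)"
      using assms(12-15) by (intro add_left_mono mult_right_mono) auto
    then have "M powr 1 \<le> M powr (m + \<alpha> * (1 - m))"
      using M0 assms(20) by (intro powr_mono') auto
    then have "M \<le> M powr m * (M powr (q * \<alpha> * (1 - m))) powr (1 / q)"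
      using M0 assms(10) by (simp add: powr_add powr_powr mult_ac)
    also have "\<dots> \<le> M powr m *
        ((M powr (q * \<alpha> * (1 - m)) - 1) / (q * \<alpha> * (1 - m) * ln M)) powr (1 / q)"
      using M0 assms(10-15,20) powr_le_mean_powr[of M "q * \<alpha> * (1 - m)"]
      by (intro mult_left_mono powr_mono2) auto
    finally have "M * (1 / (\<mu> + 1)) \<le> (M powr m *
        ((M powr (q * \<alpha> * (1 - m)) - 1) / (q * \<alpha> * (1 - m) * ln M)) powr (1 / q))
        * (1 / (p * \<mu> + 1)) powr (1 / p)"
      using M0 assms(9,21) by (intro mult_mono inverse_add_one_le_powr) auto
    then show "M * (1 / (\<mu> + 1)) \<le> M powr m * (1 / (p * \<mu> + 1)) powr (1 / p)
      * ((M powr (q * \<alpha> * (1 - m)) - 1) / (q * \<alpha> * (1 - m) * ln M)) powr (1 / q)"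
      by (simp add: mult_ac)
  qed (use assms(8) in auto)
  finally show ?thesis .
qed

end
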